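(* $\Gamma_\infty$, and hence $\mathrm{Aut}(\mathbf{C}^2)$, is not linear over any field.
   Context: $\mathrm{Aut}(\mathbf{C}^2)$ is the group of polynomial automorphisms of $\mathbf{C}^2$, under composition. It is a subgroup of the planar Cremona group $\mathrm{Cr}_2(\mathbf{C})$, the group of birational transformations of the complex affine plane. For a polynomial $f\in\mathbf{C}[X]$, let $\alpha_f(x,y)=(x,y+f(x))$, and let $s_1(x,y)=(x+1,y)$. For $n\ge 0$, $\Gamma_n$ is the subgroup generated by $s_1$ and $\alpha_{X^n}$. The paper asserts that $\Gamma_n\subset\Gamma_{n+1}$ for all $n$ and defines $\Gamma_\infty=\bigcup_{n\ge 0}\Gamma_n$, which it treats as a (locally nilpotent) group contained in $\mathrm{Aut}(\mathbf{C}^2)$. A group is linear over a field $F$ if it has a faithful finite-dimensional linear representation over $F$, i.e. an injective homomorphism into $\mathrm{GL}_d(F)$ for some finite $d$.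
   Formalization: Γ_n ⊂ Γ_{n+1} fails for n=1, and the union of the Γ_n is not a group (it contains α_X and α_{X²} but not α_{X²+X}); Γ_∞ is therefore taken to be the subgroup of Aut(C²) generated by that union. *)

theory Defs
  imports
    "HOL-Algebra.Generated_Groups"
    "HOL-Computational_Algebra.Polynomial"
    "Jordan_Normal_Form.Matrix"
begin

section \<open>Polynomial automorphisms of the affine plane\<close>

text \<open>A polynomial in \<open>\<complex>[X][Y]\<close> is evaluated at \<open>(x, y)\<close>; the outer variable is \<open>Y\<close>.\<close>

definition poly_eval2 :: "complex poly poly \<Rightarrow> complex \<times> complex \<Rightarrow> complex" where
  "poly_eval2 P p = poly (poly P [:snd p:]) (fst p)"

definition polynomial_map :: "(complex \<times> complex \<Rightarrow> complex \<times> complex) \<Rightarrow> bool" where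
  "polynomial_map F \<longleftrightarrow> (\<exists>P Q. \<forall>p. F p = (poly_eval2 P p, poly_eval2 Q p))"

text \<open>Since \<open>\<complex>\<close> is infinite, a polynomial endomorphism of the plane is determined by the map
  that it induces on points, so endomorphisms are represented by these maps.\<close>

definition End_C2 :: "(complex \<times> complex \<Rightarrow> complex \<times> complex) monoid" where
  "End_C2 = \<lparr>carrier = {F. polynomial_map F}, monoid.mult = (\<circ>), one = id\<rparr>"

definition Aut_C2 :: "(complex \<times> complex \<Rightarrow> complex \<times> complex) monoid" where
  "Aut_C2 = units_of End_C2"

definition alpha :: "complex poly \<Rightarrow> complex \<times> complex \<Rightarrow> complex \<times> complex" where
  "alpha f = (\<lambda>(x, y). (x, y + poly f x))"

definition s1 :: "complex \<times> complex \<Rightarrow> complex \<times> complex" where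
  "s1 = (\<lambda>(x, y). (x + 1, y))"

definition Gamma :: "nat \<Rightarrow> (complex \<times> complex \<Rightarrow> complex \<times> complex) set" where
  "Gamma n = generate Aut_C2 {s1, alpha (monom 1 n)}"

text \<open>The groups \<open>Gamma n\<close> do not form an increasing chain (see \<open>Gamma_1_not_subset_Gamma_2\<close>
  below), and their set-theoretic union is not closed under composition: it contains
  \<open>alpha X\<close> and \<open>alpha (X\<^sup>2)\<close> but not \<open>alpha (X\<^sup>2 + X)\<close>. The group \<open>\<Gamma>\<^sub>\<infinity>\<close> is
  therefore taken to be the subgroup generated by the union.\<close>

definition Gamma_inf :: "(complex \<times> complex \<Rightarrow> complex \<times> complex) set" where
  "Gamma_inf = generate Aut_C2 (\<Union>n. Gamma n)"

abbreviation Gamma_inf_group :: "(complex \<times> complex \<Rightarrow> complex \<times> complex) monoid" where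
  "Gamma_inf_group \<equiv> Aut_C2\<lparr>carrier := Gamma_inf\<rparr>"


section \<open>Linear groups\<close>

definition GL :: "'f::field itself \<Rightarrow> nat \<Rightarrow> 'f mat monoid" where
  "GL F d = units_of (ring_mat F d ())"

definition linear_over :: "'f::field itself \<Rightarrow> ('a, 'b) monoid_scheme \<Rightarrow> bool" where
  "linear_over F G \<longleftrightarrow> (\<exists>d. \<exists>\<rho> \<in> hom G (GL F d). inj_on \<rho> (carrier G))"


section \<open>These structures are groups\<close>

lemma group_GL: "group (GL TYPE('f::field) d)"
proof -
  interpret ring "ring_mat TYPE('f) d ()" by (rule ring_mat)
  show ?thesis unfolding GL_def by (rule units_group)
qed

lemma poly_eval2_add: "poly_eval2 (P + Q) p = poly_eval2 P p + poly_eval2 Q p"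
  and poly_eval2_mult: "poly_eval2 (P * Q) p = poly_eval2 P p * poly_eval2 Q p"
  and poly_eval2_const: "poly_eval2 [:[:c:]:] p = c"
  and poly_eval2_fst: "poly_eval2 [:[:0, 1:]:] p = fst p"
  and poly_eval2_snd: "poly_eval2 [:0, 1:] p = snd p"
  and poly_eval2_lift: "poly_eval2 [:f:] p = poly f (fst p)"
  by (simp_all add: poly_eval2_def)

lemma poly_eval2_comp:
  "\<exists>R. \<forall>p. poly_eval2 R p = poly_eval2 P (poly_eval2 A p, poly_eval2 B p)"
proof (induction P)
  case 0
  have "\<forall>p. poly_eval2 0 p = poly_eval2 0 (poly_eval2 A p, poly_eval2 B p)"
    by (simp add: poly_eval2_def)
  then show ?case by blast
next
  case (pCons a P)
  have "\<exists>R. \<forall>p. poly_eval2 R p = poly a (poly_eval2 A p)"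
  proof (induction a)
    case 0
    have "\<forall>p. poly_eval2 0 p = poly 0 (poly_eval2 A p)" by (simp add: poly_eval2_def)
    then show ?case by blast
  next
    case (pCons c a)
    then obtain R where "\<forall>p. poly_eval2 R p = poly a (poly_eval2 A p)" by blast
    then have "\<forall>p. poly_eval2 ([:[:c:]:] + A * R) p = poly (pCons c a) (poly_eval2 A p)"
      by (simp only: poly_eval2_add poly_eval2_mult poly_eval2_const poly_pCons) simp
    then show ?case by blast
  qed
  then obtain R where R: "\<And>p. poly_eval2 R p = poly a (poly_eval2 A p)" by blast
  obtain S where S: "\<And>p. poly_eval2 S p = poly_eval2 P (poly_eval2 A p, poly_eval2 B p)"
    using pCons.IH by blast
  have "poly_eval2 (R + B * S) p = poly_eval2 (pCons a P) (poly_eval2 A p, poly_eval2 B p)" for p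
    using R[of p] S[of p] by (simp add: poly_eval2_add poly_eval2_mult) (simp add: poly_eval2_def)
  then show ?case by blast
qed

lemma polynomial_map_comp:
  assumes "polynomial_map F" "polynomial_map G"
  shows "polynomial_map (F \<circ> G)"
proof -
  obtain A B where G: "\<And>p. G p = (poly_eval2 A p, poly_eval2 B p)"
    using assms(2) by (auto simp: polynomial_map_def)
  obtain P Q where F: "\<And>p. F p = (poly_eval2 P p, poly_eval2 Q p)"
    using assms(1) by (auto simp: polynomial_map_def)
  obtain R where R: "\<And>p. poly_eval2 R p = poly_eval2 P (poly_eval2 A p, poly_eval2 B p)"
    using poly_eval2_comp by blast
  obtain S where S: "\<And>p. poly_eval2 S p = poly_eval2 Q (poly_eval2 A p, poly_eval2 B p)"
    using poly_eval2_comp by blast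
  have "\<forall>p. (F \<circ> G) p = (poly_eval2 R p, poly_eval2 S p)" by (simp add: F G R S)
  then show ?thesis unfolding polynomial_map_def by blast
qed

lemma polynomial_map_id: "polynomial_map id"
proof -
  have "\<forall>p. id p = (poly_eval2 [:[:0, 1:]:] p, poly_eval2 [:0, 1:] p)"
    by (simp only: poly_eval2_fst poly_eval2_snd) simp
  then show ?thesis unfolding polynomial_map_def by blast
qed

lemma monoid_End_C2: "monoid End_C2"
  by (rule monoidI) (auto simp: End_C2_def polynomial_map_comp polynomial_map_id o_assoc)

lemma group_Aut_C2: "group Aut_C2"
  unfolding Aut_C2_def by (rule monoid.units_group[OF monoid_End_C2])

lemma mult_Aut_C2: "monoid.mult Aut_C2 = (\<circ>)" and one_Aut_C2: "one Aut_C2 = id"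
  by (simp_all add: Aut_C2_def units_of_def End_C2_def)

lemma mem_Aut_C2_iff:
  "F \<in> carrier Aut_C2 \<longleftrightarrow>
    polynomial_map F \<and> (\<exists>G. polynomial_map G \<and> G \<circ> F = id \<and> F \<circ> G = id)"
  by (auto simp: Aut_C2_def units_of_def Units_def End_C2_def)

lemma polynomial_map_alpha: "polynomial_map (alpha f)"
proof -
  have "\<forall>p. alpha f p = (poly_eval2 [:[:0, 1:]:] p, poly_eval2 ([:0, 1:] + [:f:]) p)"
    by (simp only: poly_eval2_add poly_eval2_fst poly_eval2_snd poly_eval2_lift)
       (simp add: alpha_def split: prod.split)
  then show ?thesis unfolding polynomial_map_def by blast
qed

lemma alpha_in_Aut_C2: "alpha f \<in> carrier Aut_C2"
proof -
  have "alpha (- f) \<circ> alpha f = id" "alpha f \<circ> alpha (- f) = id"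
    by (auto simp: alpha_def fun_eq_iff)
  then show ?thesis unfolding mem_Aut_C2_iff using polynomial_map_alpha by blast
qed

lemma polynomial_map_shift: "polynomial_map (\<lambda>(x, y). (x + c, y))"
proof -
  have "\<forall>p. (case p of (x, y) \<Rightarrow> (x + c, y)) =
      (poly_eval2 ([:[:0, 1:]:] + [:[:c:]:]) p, poly_eval2 [:0, 1:] p)"
    by (simp only: poly_eval2_add poly_eval2_fst poly_eval2_snd poly_eval2_const)
       (simp split: prod.split)
  then show ?thesis unfolding polynomial_map_def by blast
qed

lemma s1_in_Aut_C2: "s1 \<in> carrier Aut_C2"
proof -
  have "(\<lambda>(x, y). (x + (-1), y)) \<circ> s1 = id" "s1 \<circ> (\<lambda>(x, y). (x + (-1), y)) = id"
    by (auto simp: s1_def fun_eq_iff)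
  then show ?thesis
    unfolding mem_Aut_C2_iff using polynomial_map_shift[of 1] polynomial_map_shift[of "-1"]
    by (auto simp: s1_def)
qed

lemma subgroup_Gamma: "subgroup (Gamma n) Aut_C2"
  unfolding Gamma_def
  by (rule group.generate_is_subgroup[OF group_Aut_C2]) (simp add: s1_in_Aut_C2 alpha_in_Aut_C2)

lemma subgroup_Gamma_inf: "subgroup Gamma_inf Aut_C2"
  unfolding Gamma_inf_def
  by (rule group.generate_is_subgroup[OF group_Aut_C2]) (use subgroup_Gamma subgroup.subset in blast)

lemma group_Gamma_inf: "group Gamma_inf_group"
  by (rule subgroup.subgroup_is_group[OF subgroup_Gamma_inf group_Aut_C2])

text \<open>Every element of \<open>Gamma 2\<close> has the form \<open>(x, y) \<mapsto> (x + k, y + a x\<^sup>2 + 2 m x + c)\<close> with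
  integers \<open>k\<close>, \<open>a\<close>, \<open>m\<close>, \<open>c\<close>, whereas \<open>alpha (monom 1 1)\<close> has linear coefficient \<open>1\<close>.\<close>

lemma Gamma_1_not_subset_Gamma_2: "\<not> Gamma 1 \<subseteq> Gamma 2"
proof
  define E :: "int \<Rightarrow> int \<Rightarrow> int \<Rightarrow> int \<Rightarrow> complex \<times> complex \<Rightarrow> complex \<times> complex" where
    "E k a m c = (\<lambda>(x, y). (x + of_int k, y + (of_int a * x\<^sup>2 + 2 * of_int m * x + of_int c)))"
    for k a m c
  interpret group Aut_C2 by (rule group_Aut_C2)
  have E_comp: "E k a m c \<circ> E k' a' m' c' =
      E (k + k') (a + a') (a * k' + m + m') (a * k'\<^sup>2 + 2 * m * k' + c + c')"
    for k a m c k' a' m' c'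
    by (auto simp: E_def fun_eq_iff algebra_simps power2_eq_square)
  have E_id: "E 0 0 0 0 = id" by (auto simp: E_def)
  have inv_form: "\<exists>k a m c. inv\<^bsub>Aut_C2\<^esub> F = E k a m c"
    if "F = E k a m c" "F \<in> carrier Aut_C2" for F k a m c
  proof -
    let ?G = "E (-k) (-a) (a * k - m) (- a * k\<^sup>2 + 2 * m * k - c)"
    have "F \<circ> ?G = id"
      unfolding that(1) E_comp E_id[symmetric] by (simp add: algebra_simps power2_eq_square)
    have "(inv\<^bsub>Aut_C2\<^esub> F) \<circ> F = id"
      using l_inv[OF that(2)] by (simp add: mult_Aut_C2 one_Aut_C2)
    then have "inv\<^bsub>Aut_C2\<^esub> F = ?G"
      using \<open>F \<circ> ?G = id\<close> by (metis comp_assoc comp_id id_comp)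
    then show ?thesis by blast
  qed
  have gens: "\<exists>k a m c. F = E k a m c" if "F \<in> {s1, alpha (monom 1 2)}" for F
  proof -
    have "s1 = E 1 0 0 0" by (auto simp: s1_def E_def)
    moreover have "alpha (monom 1 2) = E 0 1 0 0"
      by (auto simp: alpha_def E_def poly_monom)
    ultimately show ?thesis using that by blast
  qed
  have form: "\<exists>k a m c. F = E k a m c" if "F \<in> Gamma 2" for F
    using that unfolding Gamma_def
  proof (induction rule: generate.induct)
    case one
    show ?case using E_id one_Aut_C2 by metis
  next
    case (incl h)
    then show ?case by (rule gens)
  next
    case (inv h)
    then show ?case
      using gens[of h] inv_form s1_in_Aut_C2 alpha_in_Aut_C2 by blast
  next
    case (eng h1 h2)
    then show ?case using E_comp mult_Aut_C2 by metis
  qed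
  assume "Gamma 1 \<subseteq> Gamma 2"
  moreover have "alpha (monom 1 1) \<in> Gamma 1"
    unfolding Gamma_def by (rule generate.incl) simp
  ultimately obtain k a m c where eq: "alpha (monom 1 1) = E k a m c"
    using form by blast
  have val: "x = of_int a * x\<^sup>2 + 2 * of_int m * x + of_int c" for x :: complex
    using fun_cong[OF eq, of "(x, 0)"] by (simp add: alpha_def E_def poly_monom)
  have "(of_int (2 * m) :: complex) = 1"
    using val[of 0] val[of 1] val[of "-1"] by (simp add: algebra_simps) algebra
  then have "2 * m = 1" by (metis of_int_eq_1_iff)
  then show False by presburger
qed

end

theory Submission
  imports
    Defs
    "HOL-Algebra.Algebraic_Closure_Type"
    "HOL-Library.Function_Algebras"
    "Jordan_Normal_Form.Char_Poly"
begin

text \<open>\<open>\<Gamma>\<^sub>\<infinity>\<close> contains \<open>A \<rtimes> \<int>\<close>, where \<open>A = \<int>[X]\<close> and the generator \<open>s\<^sub>1\<close> of \<open>\<int>\<close> acts by the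
  shift \<open>t\<close>. In a \<open>d\<close>-dimensional representation over an algebraically closed field the weights of
  the commuting operators \<open>u(a)\<close>, \<open>a \<in> A\<close>, are finite in number and permuted by \<open>t\<close>, hence fixed by
  some \<open>t\<^sup>N\<close>. All weights are then trivial on \<open>B = (t\<^sup>N - 1)A\<close>, so \<open>B\<close> acts unipotently, trivially on the
  successive quotients of a finite flag \<open>F\<^sub>0 \<subseteq> F\<^sub>1 \<subseteq> \<dots> \<subseteq> F\<^sub>M\<close>. Let \<open>H\<^sub>k\<close> be the subgroup of \<open>B\<close> that
  fixes \<open>F\<^sub>k\<close> pointwise. On \<open>H\<^sub>k\<close> the map \<open>b \<mapsto> u(b) - 1\<close>, restricted to \<open>F\<^sub>k\<^sub>+\<^sub>1\<close>, is additive and has a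
  finite-dimensional span, so the locally nilpotent \<open>t - 1\<close> is nilpotent modulo \<open>H\<^sub>k\<^sub>+\<^sub>1\<close>. Thus a faithful
  representation forces \<open>(t - 1)\<^sup>m (t\<^sup>N - 1) = 0\<close> on \<open>\<int>[X]\<close> for some \<open>m\<close>, which fails for polynomials of
  large degree.\<close>

hide_const (open) Module.smult UnivPoly.coeff UnivPoly.monom Polynomials.degree

section \<open>Periodic points and finite spans\<close>

lemma funpow_mult_fixed:
  assumes "(f ^^ n) x = x"
  shows "(f ^^ (n * k)) x = x"
proof (induction k)
  case (Suc k)
  have "(f ^^ (n * Suc k)) x = (f ^^ n) ((f ^^ (n * k)) x)"
    by (simp add: funpow_add)
  then show ?case using Suc assms by simp
qed simp

text \<open>Gaussian elimination, one coordinate at a time. The spanning family is indexed by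
  elements of \<open>H\<close> itself, so that later it stays inside whichever subgroup
  \<open>H\<close> is.\<close>

lemma finite_span_coordinates:
  fixes g :: "'a \<Rightarrow> 'i \<Rightarrow> 'k::field"
  assumes "finite I"
  shows "\<exists>H0\<subseteq>H. finite H0 \<and> (\<forall>a\<in>H. \<exists>c. \<forall>i\<in>I. g a i = (\<Sum>h\<in>H0. c h * g h i))"
  using assms
proof (induction I arbitrary: g rule: finite_induct)
  case empty
  show ?case by (rule exI[of _ "{}"]) simp
next
  case (insert k I)
  show ?case
  proof (cases "\<exists>p\<in>H. g p k \<noteq> 0")
    case False
    obtain H0 where H0: "H0 \<subseteq> H" "finite H0"
      "\<And>a. a \<in> H \<Longrightarrow> \<exists>c. \<forall>i\<in>I. g a i = (\<Sum>h\<in>H0. c h * g h i)"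
      using insert.IH[of g] by blast
    have "\<exists>c. \<forall>i\<in>insert k I. g a i = (\<Sum>h\<in>H0. c h * g h i)" if a: "a \<in> H" for a
    proof -
      obtain c where "\<forall>i\<in>I. g a i = (\<Sum>h\<in>H0. c h * g h i)" using H0(3)[OF a] by blast
      moreover have "g a k = (\<Sum>h\<in>H0. c h * g h k)"
        using False a H0(1) by (simp add: subset_iff)
      ultimately show ?thesis by blast
    qed
    then show ?thesis using H0(1,2) by blast
  next
    case True
    then obtain p where p: "p \<in> H" "g p k \<noteq> 0" by blast
    define r where "r a = g a k / g p k" for a
    define g' where "g' a i = g a i - r a * g p i" for a i
    obtain H0 where H0: "H0 \<subseteq> H" "finite H0"
      "\<And>a. a \<in> H \<Longrightarrow> \<exists>c. \<forall>i\<in>I. g' a i = (\<Sum>h\<in>H0. c h * g' h i)"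
      using insert.IH[of g'] by blast
    have g'p: "g' p i = 0" for i using p(2) by (simp add: g'_def r_def)
    have g'k: "g' a k = 0" for a using p(2) by (simp add: g'_def r_def)
    have "\<exists>c. \<forall>i\<in>insert k I. g a i = (\<Sum>h\<in>insert p H0. c h * g h i)" if a: "a \<in> H" for a
    proof -
      obtain c where c: "\<And>i. i \<in> I \<Longrightarrow> g' a i = (\<Sum>h\<in>H0. c h * g' h i)"
        using H0(3)[OF a] by blast
      define c' where "c' h = (if h = p then r a - (\<Sum>h\<in>H0 - {p}. c h * r h) else c h)" for h
      have "g a i = (\<Sum>h\<in>insert p H0. c' h * g h i)" if "i \<in> insert k I" for i
      proof -
        have "g' a i = (\<Sum>h\<in>H0. c h * g' h i)" using c that g'k by auto
        also have "\<dots> = (\<Sum>h\<in>H0 - {p}. c h * g' h i)"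
          using H0(2) g'p by (intro sum.mono_neutral_right) auto
        also have "\<dots> = (\<Sum>h\<in>H0 - {p}. c h * g h i) - (\<Sum>h\<in>H0 - {p}. c h * r h) * g p i"
          by (simp add: g'_def algebra_simps sum_subtractf sum_distrib_left)
        finally have "g a i = c' p * g p i + (\<Sum>h\<in>H0 - {p}. c h * g h i)"
          by (simp add: g'_def c'_def algebra_simps)
        also have "\<dots> = c' p * g p i + (\<Sum>h\<in>H0 - {p}. c' h * g h i)"
          by (simp add: c'_def)
        also have "\<dots> = (\<Sum>h\<in>insert p H0. c' h * g h i)"
          using H0(2) by (simp add: sum.insert_remove)
        finally show ?thesis .
      qed
      then show ?thesis by blast
    qed
    then show ?thesis using H0(1,2) p(1) by (intro exI[of _ "insert p H0"]) simp
  qed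
qed

section \<open>Abelian groups of operators normalised by a locally unipotent twist\<close>

context vector_space
begin

definition poly_op :: "('b \<Rightarrow> 'b) \<Rightarrow> 'a poly \<Rightarrow> 'b \<Rightarrow> 'b" where
  "poly_op f p v = fold_coeffs (\<lambda>c w. c *s v + f w) p 0"

end

text \<open>The locale models a finite-dimensional representation of \<open>A \<rtimes> \<langle>t\<rangle>\<close>, with \<open>u\<close> the
  action of \<open>A\<close> and \<open>S\<close> that of the twist \<open>t\<close>. The vector space itself need not be finite-dimensional:
  only the last three assumptions, which hold for \<open>d \<times> d\<close> matrices, express finiteness.\<close>

locale twisted_unipotent_rep = vector_space scale
  for scale :: "'k::alg_closed_field \<Rightarrow> 'v::ab_group_add \<Rightarrow> 'v" (infixr \<open>*s\<close> 75) +
  fixes u :: "'a::ab_group_add \<Rightarrow> 'v \<Rightarrow> 'v"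
    and S :: "'v \<Rightarrow> 'v"
    and t :: "'a \<Rightarrow> 'a"
    and E :: "'v set"
  assumes u_vadd: "u a (v + w) = u a v + u a w"
    and u_scale: "u a (c *s v) = c *s u a v"
    and u_zero [simp]: "u 0 v = v"
    and u_add: "u (a + b) v = u a (u b v)"
    and S_vadd: "S (v + w) = S v + S w"
    and S_scale: "S (c *s v) = c *s S v"
    and S_bij: "bij S"
    and t_add: "t (a + b) = t a + t b"
    and t_surj: "surj t"
    and S_u: "S (u a v) = u (t a) (S v)"
    and t_unipotent: "\<exists>m. ((\<lambda>b. t b - b) ^^ m) a = 0"
    and finite_span: "\<exists>H0\<subseteq>H. finite H0 \<and>
          (\<forall>a\<in>H. \<exists>c. \<forall>v. u a v - v = (\<Sum>h\<in>H0. c h *s (u h v - v)))"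
    and finite_E: "finite E"
    and faithful: "(\<And>v. v \<in> E \<Longrightarrow> u a v = v) \<Longrightarrow> a = 0"
begin

lemma u_vzero [simp]: "u a 0 = 0"
  using u_scale[of a 0 0] by simp

lemma S_vzero [simp]: "S 0 = 0"
  using S_scale[of 0 0] by simp

lemma S_surj: "surj S"
  using S_bij by (rule bij_is_surj)

lemma u_vdiff: "u a (v - w) = u a v - u a w"
  by (metis add_diff_cancel_right' diff_add_cancel u_vadd)

lemma S_vdiff: "S (v - w) = S v - S w"
  by (metis add_diff_cancel_right' diff_add_cancel S_vadd)

lemma S_sum: "S (sum f A) = (\<Sum>x\<in>A. S (f x))"
  by (induction A rule: infinite_finite_induct) (simp_all add: S_vadd)

lemma t_zero [simp]: "t 0 = 0"
  using t_add[of 0 0] by simp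

lemma t_diff: "t (a - b) = t a - t b"
  by (metis add_diff_cancel_right' diff_add_cancel t_add)

lemma u_commute: "u a (u b v) = u b (u a v)"
  by (metis add.commute u_add)

lemma u_minus [simp]: "u (- a) (u a v) = v" "u a (u (- a) v) = v"
  by (simp_all flip: u_add)

section \<open>Polynomials in a single operator\<close>

lemma poly_op_0 [simp]: "poly_op f 0 v = 0"
  by (simp add: poly_op_def)

lemma poly_op_pCons [simp]: "poly_op (u a) (pCons c p) v = c *s v + u a (poly_op (u a) p v)"
  by (cases "p = 0"; cases "c = 0") (simp_all add: poly_op_def)

lemma poly_op_add: "poly_op (u a) (p + q) v = poly_op (u a) p v + poly_op (u a) q v"
  by (induction p q rule: poly_induct2) (simp_all add: u_vadd scale_left_distrib)

lemma poly_op_smult: "poly_op (u a) (smult c p) v = c *s poly_op (u a) p v"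
  by (induction p) (simp_all add: u_scale scale_right_distrib)

lemma poly_op_sum: "poly_op (u a) (sum f A) v = (\<Sum>x\<in>A. poly_op (u a) (f x) v)"
  by (induction A rule: infinite_finite_induct) (simp_all add: poly_op_add)

lemma poly_op_monom: "poly_op (u a) (monom c n) v = c *s (u a ^^ n) v"
  by (induction n) (simp_all add: monom_0 monom_Suc u_scale)

section \<open>Weights on quotients by invariant subspaces\<close>

definition invariant :: "'v set \<Rightarrow> bool" where
  "invariant F \<longleftrightarrow> subspace F \<and> (\<forall>a. \<forall>v\<in>F. u a v \<in> F)"

text \<open>Here \<open>v\<close> represents a common eigenvector in the quotient by
  \<open>F\<close>, which is encoded by congruences modulo \<open>F\<close>.\<close>

definition weight :: "'v set \<Rightarrow> 'v \<Rightarrow> ('a \<Rightarrow> 'k) \<Rightarrow> bool" where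
  "weight F v \<chi> \<longleftrightarrow> invariant F \<and> v \<notin> F \<and> (\<forall>a. u a v - \<chi> a *s v \<in> F)"

lemma invariant_subspace: "invariant F \<Longrightarrow> subspace F"
  by (simp add: invariant_def)

lemma invariant_u: "invariant F \<Longrightarrow> v \<in> F \<Longrightarrow> u a v \<in> F"
  by (simp add: invariant_def)

lemma invariant_poly_op:
  assumes "invariant F" "v \<in> F"
  shows "poly_op (u a) p v \<in> F"
  using assms
  by (induction p) (simp_all add: subspace_0 subspace_add subspace_scale invariant_subspace invariant_u)

lemma poly_op_u_diff:
  "poly_op (u a) p (u b v - c *s v) = u b (poly_op (u a) p v) - c *s poly_op (u a) p v"
proof (induction p)
  case (pCons d p)
  then show ?case
    by (simp add: u_vadd u_vdiff u_scale scale_right_diff_distrib scale_right_distrib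
        u_commute[of a b] mult.commute)
qed simp

text \<open>The operators \<open>u (n a)\<close> are the powers of \<open>u a\<close> and span a finite-dimensional space.\<close>

lemma annihilating_poly: "\<exists>p. p \<noteq> 0 \<and> (\<forall>v. poly_op (u a) p v = 0)"
proof -
  define m where "m n = ((+) a ^^ n) 0" for n
  have u_m: "u (m n) v = (u a ^^ n) v" for n v
    by (induction n) (simp_all add: m_def u_add)
  obtain H0 where H0: "H0 \<subseteq> range m" "finite H0"
    "\<And>b. b \<in> range m \<Longrightarrow> \<exists>c. \<forall>v. u b v - v = (\<Sum>h\<in>H0. c h *s (u h v - v))"
    using finite_span[of "range m"] by blast
  obtain I where I: "finite I" "inj_on m I" "H0 = m ` I"
    using H0(1,2) by (metis finite_image_iff subset_image_inj)
  \<comment> \<open>\<open>n\<close> exceeds every exponent in \<open>I\<close> and is positive even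
    for empty \<open>I\<close>, so the leading monomial of \<open>p\<close> below keeps coefficient
    1.\<close>
  define n where "n = Suc (Max (insert 0 I))"
  have n: "i < n" if "i \<in> I" for i
    using I(1) that by (simp add: n_def less_Suc_eq_le)
  obtain c where c: "\<And>v. u (m n) v - v = (\<Sum>h\<in>H0. c h *s (u h v - v))"
    using H0(3) by blast
  define p where "p = monom 1 n - 1 + (\<Sum>i\<in>I. smult (- c (m i)) (monom 1 i - 1))"
  have one: "poly_op (u a) (monom 1 i - 1) v = u (m i) v - v" for i v
  proof -
    have "monom 1 i - 1 = monom 1 i + monom (- 1 :: 'k) 0"
      by (simp add: monom_0 one_pCons)
    then show ?thesis by (simp only: poly_op_add poly_op_monom u_m) simp
  qed
  have "poly_op (u a) p v = 0" for v
    unfolding p_def poly_op_add poly_op_sum poly_op_smult one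
    using c[of v] I by (simp add: sum.reindex sum_negf)
  moreover have "coeff p n = 1"
  proof -
    have "0 < n" by (simp add: n_def)
    moreover have "coeff (monom 1 i - 1 :: 'k poly) n = 0" if "i \<in> I" for i
      using n[OF that] \<open>0 < n\<close> by (simp add: coeff_eq_0)
    ultimately show ?thesis by (simp add: p_def coeff_sum coeff_eq_0)
  qed
  ultimately show ?thesis by (intro exI[of _ p]) auto
qed

text \<open>Split a factor X - l off \<open>p\<close>, leaving \<open>q\<close>. Either
  \<open>poly_op (u a) q v\<close> lies outside \<open>F\<close> and is an eigenvector modulo
  \<open>F\<close>, or \<open>q\<close> takes the place of \<open>p\<close> with smaller
  degree.\<close>

lemma eigenvector_mod:
  assumes F: "subspace F" and "p \<noteq> 0" "v \<notin> F" "poly_op (u a) p v \<in> F"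
  shows "\<exists>q l. poly_op (u a) q v \<notin> F \<and> u a (poly_op (u a) q v) - l *s poly_op (u a) q v \<in> F"
  using assms(2-)
proof (induction "degree p" arbitrary: p rule: less_induct)
  case less
  show ?case
  proof (cases "degree p = 0")
    case True
    then obtain c where p: "p = [:c:]" by (rule degree_eq_zeroE)
    with less.prems have "c \<noteq> 0" "c *s v \<in> F" by simp_all
    then have "inverse c *s c *s v \<in> F" using subspace_scale[OF F] by blast
    with \<open>c \<noteq> 0\<close> less.prems show ?thesis by simp
  next
    case False
    then obtain l where "poly p l = 0" using alg_closed_imp_poly_has_root[of p] by blast
    then obtain q where p: "p = [:- l, 1:] * q" by (metis dvdE poly_eq_0_iff_dvd)
    have q: "q \<noteq> 0" "degree q < degree p"
      using less.prems(1) by (auto simp: p degree_mult_eq simp del: mult_pCons_left)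
    have "poly_op (u a) p v = u a (poly_op (u a) q v) - l *s poly_op (u a) q v"
      using poly_op_add[of a "pCons 0 q" "smult (- l) q" v] poly_op_smult[of a "- l" q v] by (simp add: p)
    then show ?thesis using less.hyps[OF q(2,1)] less.prems by metis
  qed
qed

lemma poly_op_eigen:
  assumes F: "invariant F" and v: "u a v - l *s v \<in> F"
  shows "poly_op (u a) p v - poly p l *s v \<in> F"
proof (induction p)
  case 0
  show ?case using F by (simp add: subspace_0 invariant_subspace)
next
  case (pCons c p)
  have "poly_op (u a) (pCons c p) v - poly (pCons c p) l *s v
      = u a (poly_op (u a) p v - poly p l *s v) + poly p l *s (u a v - l *s v)"
    by (simp add: u_vdiff u_scale algebra_simps)
  also have "\<dots> \<in> F"
    using pCons F v by (intro subspace_add subspace_scale invariant_u invariant_subspace)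
  finally show ?case .
qed

text \<open>The generators in \<open>H0\<close> are treated one at a time: a polynomial in the new
  operator commutes with the earlier ones and so preserves their eigenvector relations. The
  remaining \<open>u a\<close> follow by linear combination.\<close>

lemma weight_exists:
  assumes F: "invariant F" and v: "v \<notin> F"
  shows "\<exists>w \<chi>. weight F w \<chi>"
proof -
  have sF: "subspace F" using F by (rule invariant_subspace)
  obtain H0 where H0: "finite H0"
    "\<And>a. \<exists>c. \<forall>v. u a v - v = (\<Sum>h\<in>H0. c h *s (u h v - v))"
    using finite_span[of UNIV] by auto
  have "\<exists>w \<chi>. w \<notin> F \<and> (\<forall>a\<in>H0. u a w - \<chi> a *s w \<in> F)"
    using H0(1)
  proof (induction H0 rule: finite_induct)
    case empty
    show ?case using v by auto
  next
    case (insert a A)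
    then obtain w \<chi> where w: "w \<notin> F" "\<And>a. a \<in> A \<Longrightarrow> u a w - \<chi> a *s w \<in> F" by blast
    obtain p where "p \<noteq> 0" "poly_op (u a) p w = 0" using annihilating_poly by blast
    then obtain q l where ql: "poly_op (u a) q w \<notin> F"
      "u a (poly_op (u a) q w) - l *s poly_op (u a) q w \<in> F"
      using eigenvector_mod[OF sF _ w(1)] subspace_0[OF sF] by metis
    have "u b (poly_op (u a) q w) - (\<chi>(a := l)) b *s poly_op (u a) q w \<in> F" if "b \<in> insert a A" for b
      using that ql(2) insert.hyps invariant_poly_op[OF F w(2), of b a q]
      by (auto simp: poly_op_u_diff)
    then show ?case using ql(1) by blast
  qed
  then obtain w \<chi> where w: "w \<notin> F" "\<And>a. a \<in> H0 \<Longrightarrow> u a w - \<chi> a *s w \<in> F" by blast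
  have "\<exists>l. u a w - l *s w \<in> F" for a
  proof -
    obtain c where c: "u a w - w = (\<Sum>h\<in>H0. c h *s (u h w - w))" using H0(2) by blast
    \<comment> \<open>\<open>u a - 1\<close> is a combination of the \<open>u h - 1\<close>, whose
      eigenvalues on \<open>w\<close> modulo \<open>F\<close> are
      \<open>\<chi> h - 1\<close>.\<close>
    have "u a w - (1 + (\<Sum>h\<in>H0. c h * (\<chi> h - 1))) *s w = (\<Sum>h\<in>H0. c h *s (u h w - \<chi> h *s w))"
      using c by (simp add: algebra_simps sum.distrib sum_subtractf scale_sum_left)
    also have "\<dots> \<in> F" using w(2) by (intro subspace_sum subspace_scale sF)
    finally show ?thesis ..
  qed
  then show ?thesis using F w(1) unfolding weight_def by metis
qed

lemma weight_unique:
  assumes F: "subspace F" and "v \<notin> F" "c *s v - d *s v \<in> F"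
  shows "c = d"
proof (rule ccontr)
  assume "c \<noteq> d"
  have "inverse (c - d) *s (c *s v - d *s v) \<in> F" using assms by (intro subspace_scale)
  then show False using \<open>c \<noteq> d\<close> assms(2) by (simp flip: scale_left_diff_distrib)
qed

lemma weight_add:
  assumes w: "weight F v \<chi>"
  shows "\<chi> (a + b) = \<chi> a * \<chi> b"
proof -
  have F: "invariant F" "subspace F" and v: "v \<notin> F" "\<And>a. u a v - \<chi> a *s v \<in> F"
    using w by (auto simp: weight_def invariant_def)
  have "(u a (u b v - \<chi> b *s v) + \<chi> b *s (u a v - \<chi> a *s v)) - (u (a + b) v - \<chi> (a + b) *s v) \<in> F"
    by (intro subspace_diff[OF F(2)] subspace_add[OF F(2)] subspace_scale[OF F(2)] invariant_u[OF F(1)] v(2))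
  moreover have "(u a (u b v - \<chi> b *s v) + \<chi> b *s (u a v - \<chi> a *s v)) - (u (a + b) v - \<chi> (a + b) *s v)
      = \<chi> (a + b) *s v - (\<chi> a * \<chi> b) *s v"
    by (simp add: u_add u_vdiff u_scale algebra_simps)
  ultimately show ?thesis using weight_unique[OF F(2) v(1)] by simp
qed

lemma weight_zero:
  assumes w: "weight F v \<chi>"
  shows "\<chi> 0 = 1"
proof -
  have F: "subspace F" and v: "v \<notin> F" "u 0 v - \<chi> 0 *s v \<in> F"
    using w unfolding weight_def invariant_def by blast+
  show ?thesis using weight_unique[OF F v(1), of 1 "\<chi> 0"] v(2) by simp
qed

lemma weight_nonzero:
  assumes w: "weight F v \<chi>"
  shows "\<chi> a \<noteq> 0"
  using weight_add[OF w, of a "- a"] weight_zero[OF w] by auto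

section \<open>Finiteness and periodicity of the weights\<close>

definition weights :: "('a \<Rightarrow> 'k) set" where
  "weights = {\<chi>. \<exists>F v. weight F v \<chi>}"

text \<open>A weight is determined by its values on the finite set \<open>H0\<close>, and its value
  at \<open>h\<close> is a root of the polynomial annihilating \<open>u h\<close>.\<close>

lemma finite_weights: "finite weights"
proof -
  obtain H0 where H0: "finite H0"
    "\<And>a. \<exists>c. \<forall>v. u a v - v = (\<Sum>h\<in>H0. c h *s (u h v - v))"
    using finite_span[of UNIV] by auto
  then obtain C where C: "\<And>a v. u a v - v = (\<Sum>h\<in>H0. C a h *s (u h v - v))" by metis
  obtain p where p: "\<And>a. p a \<noteq> 0" "\<And>a v. poly_op (u a) (p a) v = 0"
    using annihilating_poly by metis
  define R where "R = PiE H0 (\<lambda>h. {l. poly (p h) l = 0})"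
  have "finite R" unfolding R_def using H0(1) p(1) by (intro finite_PiE) (auto simp: poly_roots_finite)
  moreover have "weights \<subseteq> (\<lambda>\<psi> a. 1 + (\<Sum>h\<in>H0. C a h * (\<psi> h - 1))) ` R"
  proof
    fix \<chi> assume "\<chi> \<in> weights"
    then obtain F v where F: "invariant F" "subspace F" and v: "v \<notin> F" "\<And>a. u a v - \<chi> a *s v \<in> F"
      by (auto simp: weights_def weight_def invariant_def)
    have eq: "\<chi> a = 1 + (\<Sum>h\<in>H0. C a h * (\<chi> h - 1))" for a
    proof -
      have "(\<Sum>h\<in>H0. C a h *s (u h v - \<chi> h *s v)) - (u a v - \<chi> a *s v) \<in> F"
        by (intro subspace_diff[OF F(2)] subspace_sum[OF F(2)] subspace_scale[OF F(2)] v(2))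
      moreover have "(\<Sum>h\<in>H0. C a h *s (u h v - \<chi> h *s v)) - (u a v - \<chi> a *s v)
          = \<chi> a *s v - (1 + (\<Sum>h\<in>H0. C a h * (\<chi> h - 1))) *s v"
        using C[of a v] by (simp add: algebra_simps sum.distrib sum_subtractf scale_sum_left)
      ultimately show ?thesis using weight_unique[OF F(2) v(1)] by simp
    qed
    have "poly (p h) (\<chi> h) = 0" for h
    proof -
      have "0 *s v - poly (p h) (\<chi> h) *s v \<in> F"
        using poly_op_eigen[OF F(1) v(2)[of h], of "p h"] p(2) by simp
      then show ?thesis using weight_unique[OF F(2) v(1)] by metis
    qed
    then have "restrict \<chi> H0 \<in> R" by (simp add: R_def)
    moreover have "\<chi> = (\<lambda>a. 1 + (\<Sum>h\<in>H0. C a h * (restrict \<chi> H0 h - 1)))"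
    proof
      show "\<chi> a = 1 + (\<Sum>h\<in>H0. C a h * (restrict \<chi> H0 h - 1))" for a
        by (subst eq) (simp cong: sum.cong)
    qed
    ultimately show "\<chi> \<in> (\<lambda>\<psi> a. 1 + (\<Sum>h\<in>H0. C a h * (\<psi> h - 1))) ` R"
      by (intro image_eqI[of _ _ "restrict \<chi> H0"])
  qed
  ultimately show ?thesis by (rule finite_surj)
qed

text \<open>Pull back along \<open>S\<close>: if \<open>S w\<close> has weight \<chi> modulo
  \<open>F\<close>, then \<open>w\<close> has weight \<open>\<chi> \<circ> t\<close> modulo the
  preimage of \<open>F\<close>, by \<open>S_u\<close>.\<close>

lemma weights_t:
  assumes "\<chi> \<in> weights"
  shows "\<chi> \<circ> t \<in> weights"
proof -
  obtain F v where F: "invariant F" "subspace F" and v: "v \<notin> F" "\<And>a. u a v - \<chi> a *s v \<in> F"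
    using assms by (auto simp: weights_def weight_def invariant_def)
  obtain w where w: "v = S w" using S_surj by blast
  define F' where "F' = {x. S x \<in> F}"
  have "invariant F'"
    using F by (auto simp: invariant_def F'_def S_u S_vadd S_scale subspace_def)
  moreover have "w \<notin> F'" using v(1) by (simp add: F'_def w)
  moreover have "u a w - (\<chi> \<circ> t) a *s w \<in> F'" for a
    using v(2)[of "t a"] by (simp add: F'_def w S_vdiff S_u S_scale)
  ultimately show ?thesis unfolding weights_def weight_def by blast
qed

text \<open>Precomposition with the surjective \<open>t\<close> is injective, so each weight has a
  finite, hence periodic, orbit. The product of the periods works for all weights at once.\<close>

lemma weights_periodic: "\<exists>N>0. \<forall>\<chi>\<in>weights. \<chi> \<circ> (t ^^ N) = \<chi>"
proof -
  define \<phi> where "\<phi> \<chi> = \<chi> \<circ> t" for \<chi> :: "'a \<Rightarrow> 'k"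
  have "inj \<phi>" unfolding \<phi>_def by (rule injI) (metis t_surj fun_eq_iff comp_apply surjD)
  have pow: "(\<phi> ^^ n) \<chi> = \<chi> \<circ> (t ^^ n)" for n \<chi>
  proof (induction n)
    case (Suc n)
    have "(\<phi> ^^ Suc n) \<chi> = \<chi> \<circ> (t ^^ n) \<circ> t" by (simp add: Suc \<phi>_def comp_def)
    then show ?case by (simp only: funpow_Suc_right o_assoc)
  qed simp
  have mem: "(\<phi> ^^ n) \<chi> \<in> weights" if "\<chi> \<in> weights" for n \<chi>
  proof (induction n)
    case (Suc n)
    then show ?case using weights_t[OF Suc] by (simp only: funpow.simps comp_apply \<phi>_def[symmetric])
  qed (simp add: that)
  have "\<exists>n>0. (\<phi> ^^ n) \<chi> = \<chi>" if "\<chi> \<in> weights" for \<chi>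
  proof -
    have "finite {y. \<exists>n. y = (\<phi> ^^ n) \<chi>}"
      using mem[OF that] by (intro finite_subset[OF _ finite_weights]) auto
    then show ?thesis using funpow_inj_finite[OF \<open>inj \<phi>\<close>] by metis
  qed
  then obtain n where n: "\<And>\<chi>. \<chi> \<in> weights \<Longrightarrow> n \<chi> > 0 \<and> (\<phi> ^^ n \<chi>) \<chi> = \<chi>" by metis
  have "(\<phi> ^^ (\<Prod>\<chi>\<in>weights. n \<chi>)) \<chi> = \<chi>" if "\<chi> \<in> weights" for \<chi>
    using n[OF that] finite_weights that by (simp add: prod.remove[of weights \<chi>] funpow_mult_fixed)
  moreover have "(\<Prod>\<chi>\<in>weights. n \<chi>) > 0" using n by (simp add: prod_pos)
  ultimately show ?thesis unfolding pow by blast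
qed

section \<open>The unipotent flag and its fixing subgroups\<close>

theorem eventually_trivial: "\<exists>N>0. \<exists>m. \<forall>a. ((\<lambda>b. t b - b) ^^ m) ((t ^^ N) a - a) = 0"
proof -
  define D where "D = (\<lambda>b. t b - b)"
  obtain N where N: "N > 0" "\<And>\<chi>. \<chi> \<in> weights \<Longrightarrow> \<chi> \<circ> (t ^^ N) = \<chi>"
    using weights_periodic by blast
  define B where "B = range (\<lambda>a. (t ^^ N) a - a)"
  have weight_B: "\<chi> b = 1" if w: "weight F v \<chi>" and b: "b \<in> B" for F v \<chi> b
  proof -
    obtain a where a: "b = (t ^^ N) a - a" using b by (auto simp: B_def)
    have "\<chi> \<in> weights" using w by (auto simp: weights_def)
    then have "\<chi> ((t ^^ N) a) = \<chi> a" using N(2) by (metis comp_apply)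
    moreover have "\<chi> ((t ^^ N) a) = \<chi> b * \<chi> a" using weight_add[OF w, of b a] by (simp add: a)
    ultimately show ?thesis using weight_nonzero[OF w, of a] by simp
  qed
  have tN_add: "(t ^^ N) (a + b) = (t ^^ N) a + (t ^^ N) b" for a b
    by (induction N) (simp_all add: t_add)
  have tN_diff: "(t ^^ N) (a - b) = (t ^^ N) a - (t ^^ N) b" for a b
    by (metis add_diff_cancel_right' diff_add_cancel tN_add)
  have B_t: "t b \<in> B" if b: "b \<in> B" for b
  proof -
    obtain a where "b = (t ^^ N) a - a" using b by (auto simp: B_def)
    then have "t b = (t ^^ N) (t a) - t a" by (simp add: t_diff funpow_swap1)
    then show ?thesis by (auto simp: B_def)
  qed
  have B_diff: "b - b' \<in> B" if b: "b \<in> B" "b' \<in> B" for b b'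
  proof -
    obtain a a' where "b = (t ^^ N) a - a" "b' = (t ^^ N) a' - a'" using b by (auto simp: B_def)
    then have "b - b' = (t ^^ N) (a - a') - (a - a')" by (simp add: tN_diff)
    then show ?thesis by (auto simp: B_def)
  qed

  \<comment> \<open>\<open>F (Suc k)\<close> is the preimage of the \<open>B\<close>-fixed vectors
    of the quotient by \<open>F k\<close>. No length is prescribed; \<open>F_union\<close> shows
    that the flag exhausts the space.\<close>
  define F where "F = rec_nat {0} (\<lambda>_ G. {v. \<forall>b\<in>B. u b v - v \<in> G})"
  have F_0: "F 0 = {0}" and F_Suc: "F (Suc k) = {v. \<forall>b\<in>B. u b v - v \<in> F k}" for k
    by (simp_all add: F_def)
  have F_inv: "invariant (F k)" for k
  proof (induction k)
    case 0
    show ?case by (simp add: F_0 invariant_def)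
  next
    case (Suc k)
    note sub = invariant_subspace[OF Suc]
    have "subspace (F (Suc k))"
    proof (rule subspaceI)
      show "0 \<in> F (Suc k)" by (simp add: F_Suc subspace_0[OF sub])
      show "v + w \<in> F (Suc k)" if "v \<in> F (Suc k)" "w \<in> F (Suc k)" for v w
        using that subspace_add[OF sub] by (simp add: F_Suc u_vadd add_diff_add)
      show "c *s v \<in> F (Suc k)" if "v \<in> F (Suc k)" for c v
        using that subspace_scale[OF sub] by (simp add: F_Suc u_scale flip: scale_right_diff_distrib)
    qed
    moreover have "u a v \<in> F (Suc k)" if "v \<in> F (Suc k)" for a v
      using that invariant_u[OF Suc] by (simp add: F_Suc u_commute[of _ a] flip: u_vdiff)
    ultimately show ?case by (simp add: invariant_def)
  qed
  note F_sub = invariant_subspace[OF F_inv]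
  have F_mono: "F k \<subseteq> F l" if "k \<le> l" for k l
  proof (rule lift_Suc_mono_le[OF _ that])
    show "F n \<subseteq> F (Suc n)" for n
      using invariant_u[OF F_inv] subspace_diff[OF F_sub] by (auto simp: F_Suc)
  qed
  \<comment> \<open>For \<open>b\<close> in \<open>B\<close>, \<open>S\<close> sends
    \<open>u b v - v\<close> to \<open>u (t b) (S v) - S v\<close>, and \<open>t b\<close> is again
    in \<open>B\<close>; this lowers \<open>k\<close> by one.\<close>
  have F_S: "v \<in> F k" if "S v \<in> F k" for k v
    using that
  proof (induction k arbitrary: v)
    case 0
    then have "S v = S 0" by (simp add: F_0)
    then have "v = 0" by (rule injD[OF bij_is_inj[OF S_bij]])
    then show ?case by (simp add: F_0)
  next
    case (Suc k)
    have "u b v - v \<in> F k" if "b \<in> B" for b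
    proof (rule Suc.IH)
      show "S (u b v - v) \<in> F k"
        using Suc.prems B_t[OF that] unfolding F_Suc S_vdiff S_u by blast
    qed
    then show ?case unfolding F_Suc by blast
  qed
  \<comment> \<open>Otherwise some \<open>v\<close> outside the union is a weight vector modulo it.
    The weight is trivial on \<open>B\<close>, so each \<open>u b v - v\<close> lies in some
    \<open>F k\<close>; finitely many generators bound \<open>k\<close>, which puts \<open>v\<close>
    into the next step of the flag.\<close>
  have F_union: "(\<Union>k. F k) = UNIV"
  proof (rule ccontr)
    assume "(\<Union>k. F k) \<noteq> UNIV"
    then obtain v0 where v0: "v0 \<notin> (\<Union>k. F k)" by blast
    have "invariant (\<Union>k. F k)"
    proof -
      have "subspace (\<Union>k. F k)"
      proof (rule subspaceI)
        show "0 \<in> (\<Union>k. F k)" using F_0 by blast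
        show "v + w \<in> (\<Union>k. F k)" if vw: "v \<in> (\<Union>k. F k)" "w \<in> (\<Union>k. F k)" for v w
        proof -
          obtain k l where "v \<in> F k" "w \<in> F l" using vw by blast
          then have "v + w \<in> F (max k l)"
            using F_mono[of k "max k l"] F_mono[of l "max k l"] by (intro subspace_add[OF F_sub]) auto
          then show ?thesis by blast
        qed
        show "c *s v \<in> (\<Union>k. F k)" if "v \<in> (\<Union>k. F k)" for c v
          using that subspace_scale[OF F_sub] by blast
      qed
      then show ?thesis using invariant_u[OF F_inv] by (auto simp: invariant_def)
    qed
    then obtain v \<chi> where w: "weight (\<Union>k. F k) v \<chi>" using weight_exists v0 by blast
    then have v: "v \<notin> (\<Union>k. F k)" and x: "\<And>a. u a v - \<chi> a *s v \<in> (\<Union>k. F k)"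
      by (simp_all add: weight_def)
    have "\<exists>k. u b v - v \<in> F k" if "b \<in> B" for b
      using x[of b] weight_B[OF w that] by simp
    then obtain k where k: "\<And>b. b \<in> B \<Longrightarrow> u b v - v \<in> F (k b)" by metis
    obtain H0 where H0: "H0 \<subseteq> B" "finite H0"
      "\<And>b. b \<in> B \<Longrightarrow> \<exists>c. \<forall>v. u b v - v = (\<Sum>h\<in>H0. c h *s (u h v - v))"
      using finite_span[of B] by blast
    \<comment> \<open>If \<open>H0\<close> is empty, the sums over it vanish and any value of
      \<open>Max\<close> will do.\<close>
    define M where "M = Max (k ` H0)"
    have M: "u h v - v \<in> F M" if "h \<in> H0" for h
      using F_mono[of "k h" M] k[of h] that H0(1,2) by (auto simp: M_def)
    have "u b v - v \<in> F M" if b: "b \<in> B" for b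
    proof -
      obtain c where "u b v - v = (\<Sum>h\<in>H0. c h *s (u h v - v))" using H0(3)[OF b] by blast
      then show ?thesis using M by (simp add: subspace_sum[OF F_sub] subspace_scale[OF F_sub])
    qed
    then have "v \<in> F (Suc M)" by (simp add: F_Suc)
    then show False using v by blast
  qed

  define H where "H k = {b \<in> B. \<forall>v\<in>F k. u b v = v}" for k
  have H_0: "H 0 = B" by (auto simp: H_def F_0)
  have H_diff: "b - b' \<in> H k" if b: "b \<in> H k" "b' \<in> H k" for b b' k
  proof -
    have "u (b - b') v = v" if "v \<in> F k" for v
    proof -
      have "u (b - b') v = u (- b') (u b v)" by (simp flip: u_add)
      also have "\<dots> = u (- b') (u b' v)" using b that by (simp add: H_def)
      finally show ?thesis by simp
    qed
    then show ?thesis using b B_diff by (simp add: H_def)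
  qed
  have H_t: "t b \<in> H k" if b: "b \<in> H k" for b k
  proof -
    have "u (t b) v = v" if v: "v \<in> F k" for v
    proof -
      obtain w where w: "v = S w" using S_surj by blast
      then show ?thesis using b F_S[of w k] v by (simp add: H_def flip: S_u)
    qed
    then show ?thesis using b B_t by (simp add: H_def)
  qed
  have H_D: "(D ^^ m) b \<in> H k" if "b \<in> H k" for m b k
    by (induction m) (simp_all add: that D_def H_diff H_t)
  have H_step: "\<exists>m. \<forall>b\<in>H k. (D ^^ m) b \<in> H (Suc k)" for k
  proof -
    obtain H0 where H0: "H0 \<subseteq> H k" "finite H0"
      "\<And>b. b \<in> H k \<Longrightarrow> \<exists>c. \<forall>v. u b v - v = (\<Sum>h\<in>H0. c h *s (u h v - v))"
      using finite_span[of "H k"] by blast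
    obtain m where m: "\<And>b. (D ^^ m b) b = 0" using t_unipotent unfolding D_def by metis
    have D_zero: "(D ^^ n) 0 = 0" for n by (induction n) (simp_all add: D_def)
    \<comment> \<open>Local nilpotency gives each element its own exponent; the finitely many
      generators share one.\<close>
    define M where "M = Max (m ` H0)"
    have M: "(D ^^ M) h = 0" if "h \<in> H0" for h
    proof -
      have "m h \<le> M" using that H0(2) by (simp add: M_def)
      then have "(D ^^ M) h = (D ^^ (M - m h)) ((D ^^ m h) h)" by (metis funpow_add comp_apply le_add_diff_inverse2)
      then show ?thesis by (simp add: m D_zero)
    qed
    \<comment> \<open>On \<open>F (Suc k)\<close> the map \<open>u b - 1\<close> has values in
      \<open>F k\<close>, which \<open>D b\<close> fixes. Hence the product
      \<open>u (D b) (u b v)\<close> expands without a cross term, and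
      \<open>b \<mapsto> u b - 1\<close> becomes additive.\<close>
    have D_u: "u (D b) v - v = (u (t b) v - v) - (u b v - v)" if b: "b \<in> H k" and v: "v \<in> F (Suc k)" for b v
    proof -
      have "D b \<in> H k" using H_D[OF b, of 1] by simp
      moreover have "u b v - v \<in> F k" using b v by (simp add: H_def F_Suc)
      ultimately have "u (D b) (u b v - v) = u b v - v" by (simp add: H_def)
      moreover have "u (t b) v = u (D b) (u b v)" by (simp add: D_def flip: u_add)
      ultimately show ?thesis by (simp add: u_vdiff algebra_simps)
    qed
    have "(D ^^ M) b \<in> H (Suc k)" if b: "b \<in> H k" for b
    proof -
      obtain c where c: "\<And>v. u b v - v = (\<Sum>h\<in>H0. c h *s (u h v - v))" using H0(3)[OF b] by blast
      \<comment> \<open>The coefficients \<open>c\<close> survive every application of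
        \<open>D\<close>: transport by \<open>S\<close> yields the relation for \<open>t\<close>,
        and \<open>D_u\<close> subtracts the old one. At \<open>n = M\<close> the right side is
        zero.\<close>
      have *: "u ((D ^^ n) b) v - v = (\<Sum>h\<in>H0. c h *s (u ((D ^^ n) h) v - v))" if "v \<in> F (Suc k)" for n v
        using that
      proof (induction n arbitrary: v)
        case 0
        show ?case using c by simp
      next
        case (Suc n)
        obtain w where w: "v = S w" using S_surj by blast
        have wF: "w \<in> F (Suc k)" using F_S Suc.prems w by blast
        have S_x: "u (t a) v - v = S (u a w - w)" for a by (simp add: w S_vdiff S_u)
        have "u (t ((D ^^ n) b)) v - v = (\<Sum>h\<in>H0. c h *s (u (t ((D ^^ n) h)) v - v))"
          unfolding S_x Suc.IH[OF wF] by (simp add: S_sum S_scale)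
        moreover have "u ((D ^^ Suc n) a) v - v = (u (t ((D ^^ n) a)) v - v) - (u ((D ^^ n) a) v - v)"
          if "a \<in> H k" for a
          using D_u[OF H_D[OF that] Suc.prems] by simp
        moreover have "h \<in> H k" if "h \<in> H0" for h using H0(1) that by blast
        ultimately show ?case
          using Suc.IH[OF Suc.prems] b
          by (simp only: scale_right_diff_distrib[where y = "_ - _"] sum_subtractf cong: sum.cong)
      qed
      have "u ((D ^^ M) b) v = v" if "v \<in> F (Suc k)" for v
      proof -
        have "u ((D ^^ M) b) v - v = (\<Sum>h\<in>H0. c h *s (u ((D ^^ M) h) v - v))" using * that by blast
        also have "\<dots> = 0" using M by simp
        finally show ?thesis by simp
      qed
      moreover have "(D ^^ M) b \<in> B" using H_D[OF b, of M] by (simp add: H_def)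
      ultimately show ?thesis by (simp add: H_def)
    qed
    then show ?thesis by blast
  qed
  have H_power: "\<exists>m. \<forall>b\<in>B. (D ^^ m) b \<in> H k" for k
  proof (induction k)
    case 0
    show ?case by (rule exI[of _ 0]) (simp add: H_0)
  next
    case (Suc k)
    then obtain m n where "\<forall>b\<in>B. (D ^^ m) b \<in> H k" "\<forall>b\<in>H k. (D ^^ n) b \<in> H (Suc k)"
      using H_step by blast
    then have "\<forall>b\<in>B. (D ^^ (n + m)) b \<in> H (Suc k)" by (simp add: funpow_add)
    then show ?case by blast
  qed
  have "\<exists>k. v \<in> F k" for v using F_union by blast
  then obtain k where k: "\<And>v. v \<in> F (k v)" by metis
  \<comment> \<open>One step of the flag contains the finite test set \<open>E\<close>, so
    \<open>faithful\<close> forces every element of \<open>H K\<close> to be zero.\<close>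
  define K where "K = Max (k ` E)"
  have K: "v \<in> F K" if "v \<in> E" for v
    using F_mono[of "k v" K] k[of v] that finite_E by (auto simp: K_def)
  obtain m where "\<And>b. b \<in> B \<Longrightarrow> (D ^^ m) b \<in> H K" using H_power by blast
  then have "(D ^^ m) b = 0" if "b \<in> B" for b
    using faithful[of "(D ^^ m) b"] K that by (simp add: H_def)
  then have "\<forall>a. (D ^^ m) ((t ^^ N) a - a) = 0" by (simp add: B_def)
  then show ?thesis using N(1) unfolding D_def by (intro exI[of _ N] exI[of _ m] conjI)
qed

end

section \<open>Differences of shifted polynomials\<close>

text \<open>For f = a + X q the difference is X (q(X+h) - q) + h q(X+h). Both summands contribute to
  the top coefficient, so degree bound and coefficient are carried through one induction.\<close>

lemma pcompose_shift_diff: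
  fixes f :: "'a::idom poly"
  assumes "degree f \<le> Suc n"
  shows "degree (f \<circ>\<^sub>p [:h, 1:] - f) \<le> n \<and>
    coeff (f \<circ>\<^sub>p [:h, 1:] - f) n = of_nat (Suc n) * h * coeff f (Suc n)"
  using assms
proof (induction n arbitrary: f)
  case 0
  obtain a b where "f = [:a, b:]"
    using 0 by (metis One_nat_def degree1_coeffs degree_0_id le_SucE le_zero_eq pCons_0_0)
  then show ?case by (simp add: pcompose_pCons)
next
  case (Suc n)
  obtain a q where f: "f = pCons a q" by (cases f)
  have q: "degree q \<le> Suc n"
    using Suc.prems by (cases "q = 0") (simp_all add: f)
  let ?g = "q \<circ>\<^sub>p [:h, 1:] - q"
  have g: "degree ?g \<le> n" "coeff ?g n = of_nat (Suc n) * h * coeff q (Suc n)"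
    using Suc.IH[OF q] by simp_all
  have "f \<circ>\<^sub>p [:h, 1:] - f = pCons 0 ?g + smult h (q \<circ>\<^sub>p [:h, 1:])"
    by (simp add: f pcompose_pCons algebra_simps)
  moreover have "degree (pCons 0 ?g) \<le> Suc n" using g(1) by (simp add: degree_pCons_le le_trans)
  moreover have "degree (smult h (q \<circ>\<^sub>p [:h, 1:])) \<le> Suc n"
    using q by (auto simp: degree_pcompose intro: order.trans[OF degree_smult_le])
  moreover have "coeff (q \<circ>\<^sub>p [:h, 1:]) (Suc n) = coeff q (Suc n)"
    using coeff_eq_0[of ?g "Suc n"] g(1) by simp
  ultimately show ?case
    using g(2) by (simp only: degree_add_le coeff_add coeff_smult coeff_pCons_Suc)
      (simp add: f algebra_simps)
qed

text \<open>Characteristic 0 keeps the top coefficient of the difference nonzero. For constants the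
  truncated subtraction gives the correct degree 0.\<close>

lemma degree_pcompose_shift_diff:
  fixes f :: "'a::{idom, ring_char_0} poly"
  assumes "h \<noteq> 0"
  shows "degree (f \<circ>\<^sub>p [:h, 1:] - f) = degree f - 1"
proof (cases "degree f")
  case 0
  then obtain c where "f = [:c:]" by (rule degree_eq_zeroE)
  then show ?thesis by simp
next
  case (Suc n)
  then have "coeff f (Suc n) \<noteq> 0" by (metis degree_0 leading_coeff_0_iff nat.distinct(1))
  then have "degree (f \<circ>\<^sub>p [:h, 1:] - f) \<le> n" "coeff (f \<circ>\<^sub>p [:h, 1:] - f) n \<noteq> 0"
    using pcompose_shift_diff[of f n h] assms Suc
    by (auto simp del: of_nat_Suc)
  then show ?thesis using Suc le_degree by (metis diff_Suc_1 le_antisym)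
qed

text \<open>The sign is that of conjugation by \<open>s1\<close>, see
  \<open>s1_alpha_int\<close>.\<close>

abbreviation shift :: "int poly \<Rightarrow> int poly" where
  "shift f \<equiv> f \<circ>\<^sub>p [:- 1, 1:]"

lemma shift_funpow: "(shift ^^ n) f = f \<circ>\<^sub>p [:- int n, 1:]"
proof (induction n)
  case (Suc n)
  have "[:- int n, 1:] \<circ>\<^sub>p [:- 1, 1:] = [:- int (Suc n), 1:]" by (simp add: pcompose_pCons)
  then have "shift (f \<circ>\<^sub>p [:- int n, 1:]) = f \<circ>\<^sub>p [:- int (Suc n), 1:]"
    by (metis pcompose_assoc)
  then show ?case using Suc by simp
qed simp

lemma degree_shift_diff_funpow: "degree (((\<lambda>g. shift g - g) ^^ m) f) = degree f - m"
  by (induction m) (simp_all add: degree_pcompose_shift_diff)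

text \<open>The degree count ends at a constant, which one further difference kills.\<close>

lemma shift_diff_nilpotent: "\<exists>m. ((\<lambda>g. shift g - g) ^^ m) f = 0"
proof -
  obtain c where "((\<lambda>g. shift g - g) ^^ degree f) f = [:c:]"
    using degree_shift_diff_funpow[of "degree f" f] by (auto elim: degree_eq_zeroE)
  then have "((\<lambda>g. shift g - g) ^^ Suc (degree f)) f = 0" by simp
  then show ?thesis by blast
qed

lemma shift_diff_not_nilpotent:
  assumes "N > 0"
  shows "\<exists>f. ((\<lambda>g. shift g - g) ^^ m) ((shift ^^ N) f - f) \<noteq> 0"
proof
  \<comment> \<open>The outer difference costs one degree and the \<open>m\<close> others cost
    \<open>m\<close>. Starting at \<open>m + 2\<close> leaves degree 1, which certifies a nonzero
    polynomial; degree 0 would not.\<close>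
  let ?f = "monom 1 (m + 2) :: int poly"
  have "degree ((shift ^^ N) ?f - ?f) = m + 1"
    using assms by (simp add: shift_funpow degree_pcompose_shift_diff degree_monom_eq)
  then have "degree (((\<lambda>g. shift g - g) ^^ m) ((shift ^^ N) ?f - ?f)) = 1"
    by (simp add: degree_shift_diff_funpow)
  then show "((\<lambda>g. shift g - g) ^^ m) ((shift ^^ N) ?f - ?f) \<noteq> 0" by (metis degree_0 zero_neq_one)
qed

section \<open>Integer polynomials inside the group\<close>

text \<open>Integer coefficients are what compositions and inverses of the generators
  \<open>alpha (monom 1 n)\<close> produce.\<close>

definition alpha_int :: "int poly \<Rightarrow> complex \<times> complex \<Rightarrow> complex \<times> complex" where
  "alpha_int f = alpha (map_poly of_int f)"

lemma alpha_int_apply: "alpha_int f (x, y) = (x, y + poly (map_poly of_int f) x)"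
  by (simp add: alpha_int_def alpha_def)

lemma alpha_int_add: "alpha_int (f + g) = alpha_int f \<circ> alpha_int g"
  by (auto simp: fun_eq_iff alpha_int_apply of_int_hom.map_poly_hom_add)

lemma alpha_int_0: "alpha_int 0 = id"
  by (auto simp: fun_eq_iff alpha_int_apply)

lemma s1_alpha_int: "s1 \<circ> alpha_int f = alpha_int (shift f) \<circ> s1"
  by (auto simp: fun_eq_iff alpha_int_apply s1_def of_int_hom.map_poly_pcompose poly_pcompose)

lemma alpha_int_eq_id:
  assumes "alpha_int f = id"
  shows "f = 0"
proof -
  have "poly (map_poly of_int f) x = 0" for x :: complex
    using fun_cong[OF assms, of "(x, 0)"] by (simp add: alpha_int_apply)
  then have "map_poly of_int f = (0 :: complex poly)" by (subst poly_all_0_iff_0[symmetric]) blast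
  then show ?thesis by simp
qed

lemma s1_in_Gamma_inf: "s1 \<in> Gamma_inf"
  unfolding Gamma_inf_def Gamma_def by (intro generate.incl UN_I[of 0]) simp_all

text \<open>\<open>alpha_int\<close> turns sums into compositions, so the \<open>f\<close> with
  image in \<open>Gamma_inf\<close> form an additive subgroup containing all powers of X.\<close>

lemma alpha_int_in_Gamma_inf: "alpha_int f \<in> Gamma_inf"
proof -
  interpret Gamma_inf: subgroup Gamma_inf Aut_C2 by (rule subgroup_Gamma_inf)
  interpret group Aut_C2 by (rule group_Aut_C2)
  have add: "alpha_int (f + g) \<in> Gamma_inf" if "alpha_int f \<in> Gamma_inf" "alpha_int g \<in> Gamma_inf" for f g
    using Gamma_inf.m_closed[OF that] by (simp add: alpha_int_add mult_Aut_C2)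
  have zero: "alpha_int 0 \<in> Gamma_inf"
    using Gamma_inf.one_closed by (simp add: alpha_int_0 one_Aut_C2)
  have monom: "alpha_int (monom 1 n) \<in> Gamma_inf" for n
    unfolding Gamma_inf_def Gamma_def
    by (intro generate.incl UN_I[of n]) (simp_all add: alpha_int_def map_poly_monom)
  have inv: "alpha_int (- f) \<in> Gamma_inf" if f: "alpha_int f \<in> Gamma_inf" for f
  proof -
    have "alpha_int (- f) \<otimes>\<^bsub>Aut_C2\<^esub> alpha_int f = \<one>\<^bsub>Aut_C2\<^esub>"
      by (simp add: mult_Aut_C2 one_Aut_C2 alpha_int_0 flip: alpha_int_add)
    then have "inv\<^bsub>Aut_C2\<^esub> alpha_int f = alpha_int (- f)"
      by (rule inv_equality) (simp_all add: alpha_int_def alpha_in_Aut_C2)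
    then show ?thesis using Gamma_inf.m_inv_closed[OF f] by simp
  qed
  have "alpha_int (monom c n) \<in> Gamma_inf" for c n
  proof (induction c rule: int_induct[where k = 0])
    case base
    show ?case using zero by simp
  next
    case (step1 c)
    then show ?case using add monom by (simp flip: add_monom)
  next
    case (step2 c)
    then show ?case using add[OF _ inv[OF monom]] by (simp flip: diff_monom)
  qed
  then have "alpha_int (\<Sum>n\<in>A. monom (coeff f n) n) \<in> Gamma_inf" for A
    by (induction A rule: infinite_finite_induct) (simp_all add: zero add)
  then show ?thesis by (metis poly_as_sum_of_monoms)
qed

section \<open>Matrices acting on sequences\<close>

lemma sum_apply: "sum f A x = (\<Sum>a\<in>A. f a x)"
  by (induction A rule: infinite_finite_induct) simp_all

definition scale_fun :: "'k::field \<Rightarrow> (nat \<Rightarrow> 'k) \<Rightarrow> nat \<Rightarrow> 'k" where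
  "scale_fun c v = (\<lambda>i. c * v i)"

lemma vector_space_scale_fun: "vector_space scale_fun"
  by standard (simp_all add: scale_fun_def fun_eq_iff algebra_simps)

text \<open>Coordinates beyond \<open>d\<close> are left alone, so that a \<open>d \<times> d\<close> matrix acts on
  one and the same type for every \<open>d\<close> and the identity matrix acts as the identity.\<close>

definition mat_act :: "nat \<Rightarrow> 'f::field mat \<Rightarrow> (nat \<Rightarrow> 'f alg_closure) \<Rightarrow> nat \<Rightarrow> 'f alg_closure" where
  "mat_act d A v = (\<lambda>i. if i < d then \<Sum>j<d. to_ac (A $$ (i, j)) * v j else v i)"

lemma mat_act_add: "mat_act d A (v + w) = mat_act d A v + mat_act d A w"
  by (simp add: mat_act_def fun_eq_iff algebra_simps sum.distrib)

lemma mat_act_scale: "mat_act d A (scale_fun c v) = scale_fun c (mat_act d A v)"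
  by (simp add: mat_act_def scale_fun_def fun_eq_iff sum_distrib_left mult.left_commute)

lemma mat_act_mult:
  assumes "A \<in> carrier_mat d d" "B \<in> carrier_mat d d"
  shows "mat_act d (A * B) v = mat_act d A (mat_act d B v)"
proof
  fix i
  have "(A * B) $$ (i, j) = (\<Sum>k<d. A $$ (i, k) * B $$ (k, j))" if "i < d" "j < d" for j
    using assms that by (simp add: scalar_prod_def atLeast0LessThan)
  then have "(\<Sum>j<d. to_ac ((A * B) $$ (i, j)) * v j)
      = (\<Sum>j<d. \<Sum>k<d. to_ac (A $$ (i, k)) * (to_ac (B $$ (k, j)) * v j))" if "i < d"
    using that by (simp add: to_ac_sum sum_distrib_right mult.assoc)
  also have "\<dots> = (\<Sum>k<d. to_ac (A $$ (i, k)) * (\<Sum>j<d. to_ac (B $$ (k, j)) * v j))"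
    by (subst sum.swap) (simp add: sum_distrib_left)
  finally show "mat_act d (A * B) v i = mat_act d A (mat_act d B v) i"
    by (simp add: mat_act_def)
qed

lemma mat_act_one: "mat_act d (1\<^sub>m d) v = v"
proof
  show "mat_act d (1\<^sub>m d) v i = v i" for i
    by (cases "i < d") (simp_all add: mat_act_def if_distrib[of to_ac] if_distrib[of "\<lambda>x. x * _"] cong: if_cong)
qed

text \<open>The test vectors are the first \<open>d\<close> unit vectors. They recover the entries
  of \<open>A\<close> in the algebraic closure, and \<open>to_ac\<close> is injective.\<close>

lemma mat_act_eq_one:
  assumes A: "A \<in> carrier_mat d d"
    and fixed: "\<And>v. v \<in> (\<lambda>j i. of_bool (i = j)) ` {..<d} \<Longrightarrow> mat_act d A v = v"
  shows "A = 1\<^sub>m d"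
proof (rule eq_matI)
  fix i j assume ij: "i < dim_row (1\<^sub>m d :: 'a mat)" "j < dim_col (1\<^sub>m d :: 'a mat)"
  have "mat_act d A (\<lambda>i. of_bool (i = j)) i = of_bool (i = j)"
    using fixed[of "\<lambda>i. of_bool (i = j)"] ij by auto
  then have "to_ac (A $$ (i, j)) = to_ac (of_bool (i = j))"
    using ij by (simp add: mat_act_def if_distrib[of "\<lambda>x. _ * x"] of_bool_def sum.delta cong: if_cong split: if_splits)
  then show "A $$ (i, j) = 1\<^sub>m d $$ (i, j)" using ij by simp
qed (use A in auto)

text \<open>The operator minus the identity vanishes beyond coordinate \<open>d\<close> and is given
  by \<open>d * d\<close> entries, to which \<open>finite_span_coordinates\<close> applies.\<close>

lemma mat_act_finite_span:
  "\<exists>H0\<subseteq>H. finite H0 \<and> (\<forall>a\<in>H. \<exists>c. \<forall>v.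
    mat_act d (M a) v - v = (\<Sum>h\<in>H0. scale_fun (c h) (mat_act d (M h) v - v)))"
proof -
  define g where "g a = (\<lambda>(i, j). to_ac (M a $$ (i, j)) - of_bool (i = j))" for a
  have g: "mat_act d (M a) v i - v i = (\<Sum>j<d. g a (i, j) * v j)" if "i < d" for a v i
    using that by (simp add: mat_act_def g_def left_diff_distrib sum_subtractf of_bool_def
        if_distribR if_distrib[of "\<lambda>x. x * _"] sum.delta cong: if_cong)
  obtain H0 where H0: "H0 \<subseteq> H" "finite H0"
    "\<And>a. a \<in> H \<Longrightarrow> \<exists>c. \<forall>x\<in>{..<d} \<times> {..<d}. g a x = (\<Sum>h\<in>H0. c h * g h x)"
    using finite_span_coordinates[of "{..<d} \<times> {..<d}" H g] by blast
  have "\<exists>c. \<forall>v. mat_act d (M a) v - v = (\<Sum>h\<in>H0. scale_fun (c h) (mat_act d (M h) v - v))"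
    if "a \<in> H" for a
  proof -
    obtain c where c: "\<And>i j. i < d \<Longrightarrow> j < d \<Longrightarrow> g a (i, j) = (\<Sum>h\<in>H0. c h * g h (i, j))"
      using H0(3)[OF \<open>a \<in> H\<close>] by auto
    have "(mat_act d (M a) v - v) i = (\<Sum>h\<in>H0. scale_fun (c h) (mat_act d (M h) v - v)) i" for v i
    proof (cases "i < d")
      case True
      have "(\<Sum>j<d. g a (i, j) * v j) = (\<Sum>j<d. \<Sum>h\<in>H0. c h * (g h (i, j) * v j))"
        using c True by (simp add: sum_distrib_right mult.assoc)
      also have "\<dots> = (\<Sum>h\<in>H0. c h * (\<Sum>j<d. g h (i, j) * v j))"
        by (subst sum.swap) (simp add: sum_distrib_left)
      finally show ?thesis using g[OF True] by (simp add: sum_apply scale_fun_def)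
    next
      case False
      then show ?thesis by (simp add: sum_apply scale_fun_def mat_act_def)
    qed
    then show ?thesis by blast
  qed
  then show ?thesis using H0(1,2) by blast
qed

section \<open>Nonlinearity\<close>

text \<open>Extending scalars to the algebraic closure turns a faithful representation into an
  instance of \<open>twisted_unipotent_rep\<close>, with \<open>E\<close> the first \<open>d\<close>
  unit vectors. Then \<open>eventually_trivial\<close> contradicts
  \<open>shift_diff_not_nilpotent\<close>.\<close>

lemma Gamma_inf_not_linear: "\<not> linear_over TYPE('f::field) Gamma_inf_group"
proof
  assume "linear_over TYPE('f) Gamma_inf_group"
  then obtain d \<rho> where hom: "\<rho> \<in> hom Gamma_inf_group (GL TYPE('f) d)" and inj: "inj_on \<rho> Gamma_inf"
    by (auto simp: linear_over_def)
  interpret group_hom Gamma_inf_group "GL TYPE('f) d" \<rho>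
    by (intro group_hom.intro group_hom_axioms.intro group_Gamma_inf group_GL hom)
  have carr: "\<rho> F \<in> carrier_mat d d" if "F \<in> Gamma_inf" for F
    using hom_closed[of F] that by (auto simp: GL_def units_of_def Units_def ring_mat_simps)
  have mult: "\<rho> (F \<circ> F') = \<rho> F * \<rho> F'" if "F \<in> Gamma_inf" "F' \<in> Gamma_inf" for F F'
    using hom_mult[of F F'] that by (simp add: GL_def units_of_def ring_mat_simps mult_Aut_C2)
  have one: "\<rho> id = 1\<^sub>m d"
    using hom_one by (simp add: GL_def units_of_def ring_mat_simps one_Aut_C2)
  have act_mult: "mat_act d (\<rho> (F \<circ> F')) v = mat_act d (\<rho> F) (mat_act d (\<rho> F') v)"
    if "F \<in> Gamma_inf" "F' \<in> Gamma_inf" for F F' v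
    using that by (simp add: mult carr mat_act_mult)
  obtain s' where s': "s' \<in> Gamma_inf" "s1 \<circ> s' = id" "s' \<circ> s1 = id"
    using G.r_inv[of s1] G.l_inv[of s1] G.inv_closed[of s1] s1_in_Gamma_inf
    by (simp add: mult_Aut_C2 one_Aut_C2)
  have id_mem: "id \<in> Gamma_inf" using G.one_closed by (simp add: one_Aut_C2)
  interpret twisted_unipotent_rep scale_fun "\<lambda>f. mat_act d (\<rho> (alpha_int f))"
    "mat_act d (\<rho> s1)" shift "(\<lambda>j i. of_bool (i = j)) ` {..<d}"
  proof (rule twisted_unipotent_rep.intro[OF vector_space_scale_fun], unfold_locales)
    show "bij (mat_act d (\<rho> s1))"
    proof (rule o_bij)
      show "mat_act d (\<rho> s') \<circ> mat_act d (\<rho> s1) = id" "mat_act d (\<rho> s1) \<circ> mat_act d (\<rho> s') = id"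
        using s'(1) s1_in_Gamma_inf
        by (simp_all add: fun_eq_iff[of _ id] s'(2,3) one mat_act_one flip: act_mult)
    qed
    show "surj shift"
    proof (rule surjI)
      have "[:1, 1:] \<circ>\<^sub>p [:- 1, 1:] = [:0, 1:: int:]" by (simp add: pcompose_pCons)
      then show "shift (f \<circ>\<^sub>p [:1, 1:]) = f" for f by (metis pcompose_assoc pcompose_idR)
    qed
    show "f = 0" if "\<And>v. v \<in> (\<lambda>j i. of_bool (i = j)) ` {..<d} \<Longrightarrow> mat_act d (\<rho> (alpha_int f)) v = v" for f
    proof -
      have "\<rho> (alpha_int f) = \<rho> id"
        unfolding one by (rule mat_act_eq_one[OF carr[OF alpha_int_in_Gamma_inf] that])
      then show ?thesis
        using inj_onD[OF inj _ alpha_int_in_Gamma_inf id_mem] alpha_int_eq_id by blast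
    qed
    show "mat_act d (\<rho> s1) (mat_act d (\<rho> (alpha_int f)) v)
        = mat_act d (\<rho> (alpha_int (shift f))) (mat_act d (\<rho> s1) v)" for f v
      by (simp add: s1_in_Gamma_inf alpha_int_in_Gamma_inf s1_alpha_int flip: act_mult)
    show "\<exists>H0\<subseteq>H. finite H0 \<and> (\<forall>a\<in>H. \<exists>c. \<forall>v. mat_act d (\<rho> (alpha_int a)) v - v =
        (\<Sum>h\<in>H0. scale_fun (c h) (mat_act d (\<rho> (alpha_int h)) v - v)))" for H
      by (rule mat_act_finite_span)
    show "mat_act d (\<rho> (alpha_int (f + g))) v = mat_act d (\<rho> (alpha_int f)) (mat_act d (\<rho> (alpha_int g)) v)"
      for f g v
      by (simp add: alpha_int_add act_mult alpha_int_in_Gamma_inf)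
    show "mat_act d (\<rho> (alpha_int 0)) v = v" for v
      by (simp add: alpha_int_0 one mat_act_one)
  qed (rule mat_act_add mat_act_scale pcompose_add shift_diff_nilpotent finite_imageI finite_lessThan)+
  show False using eventually_trivial shift_diff_not_nilpotent by blast
qed

lemma linear_over_subgroup:
  assumes "linear_over F G" "H \<subseteq> carrier G"
  shows "linear_over F (G\<lparr>carrier := H\<rparr>)"
proof -
  obtain d \<rho> where "\<rho> \<in> hom G (GL F d)" "inj_on \<rho> (carrier G)"
    using assms(1) by (auto simp: linear_over_def)
  then have "\<rho> \<in> hom (G\<lparr>carrier := H\<rparr>) (GL F d)" "inj_on \<rho> (carrier (G\<lparr>carrier := H\<rparr>))"
    using assms(2) by (auto simp: hom_def intro: inj_on_subset)
  then show ?thesis by (auto simp: linear_over_def)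
qed

theorem proposition2p3:
  shows "\<not> linear_over TYPE('f::field) Gamma_inf_group \<and> \<not> linear_over TYPE('f) Aut_C2"
  using Gamma_inf_not_linear linear_over_subgroup[OF _ subgroup.subset[OF subgroup_Gamma_inf]] by blast

end
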